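(* Let $(T,X)$ be a minimal invertible semiflow on a nonempty compact Hausdorff space $X$ with $T$ abelian, and let $x\in X$. Then the following are pairwise equivalent: (1) $Q_{(T,X)}[x]=\{x\}$; (a) $Q_{(X,T)}[x]=\{x\}$; (2) $x\in P_{aa}(T,X)$; (b) $x\in P_{aa}(X,T)$; (3) $x$ is a distal and l.a.p. point of $(T,X)$; (c) $x$ is a distal and l.a.p. point of $(X,T)$.
   Context: $T$ is a topological semigroup with identity $e$. A semiflow $(T,X)$ is a jointly continuous map $T\times X\to X$, $(t,x)\mapsto tx$, with $ex=x$ and $t(sx)=(ts)x$. It is minimal if every orbit $Tx$ is dense in $X$, and invertible if each transition $x\mapsto tx$, $t\in T$, is a bijection of $X$. For invertible $(T,X)$, the reflection $(X,T)$ is the (right-action) semiflow $(x,t)\mapsto xt:=t^{-1}x$. The following notions are defined for $(T,X)$; those for $(X,T)$ are the same with $tx$ replaced throughout by $xt=t^{-1}x$ (since $T$ is abelian, the side on which syndeticity is taken is immaterial). $x'\in Q_{(T,X)}[x]$ if there are nets $\{x_n\},\{x_n'\}$ in $X$ and $\{t_n\}$ in $T$ with $x_n\to x$, $x_n'\to x'$ and $\lim_n t_nx_n=\lim_n t_nx_n'$. $x\in P_{aa}(T,X)$ (almost automorphic point) if for every net $\{t_n\}$ in $T$ and net $\{x_n'\}$ in $X$: $t_nx\to y$, $x_n'\to x'$ and $t_nx_n'=y$ for all $n$ imply $x=x'$. A set $A\subseteq T$ is syndetic if there is a compact $K\subseteq T$ with $Kt\cap A\ne\emptyset$ for all $t\in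 T$. $x$ is locally almost periodic (l.a.p.) if for every neighborhood $U$ of $x$ there are a neighborhood $V$ of $x$ and a syndetic $A\subseteq T$ with $AV\subseteq U$. $x,y$ are proximal if there is a net $\{t_n\}$ in $T$ with $\lim_n t_nx=\lim_n t_ny$; $x$ is distal if it is proximal only to itself within the closure of its orbit. *)

theory Defs
  imports "HOL-Analysis.Analysis"
begin

subsection \<open>Nets\<close>

text \<open>
  A net is a function \<open>f\<close> on a directed set \<open>(D, le)\<close>, where \<open>le\<close> is a preorder on \<open>D\<close>
  (antisymmetry is not required).  It converges to \<open>l\<close> iff
  \<open>(f \<longlongrightarrow> l) (tail_filter D le)\<close>; see \<open>tendsto_tail_filter\<close>.
  The values of \<open>f\<close> outside \<open>D\<close> play no role.
\<close>

definition directed :: "'i set \<Rightarrow> ('i \<Rightarrow> 'i \<Rightarrow> bool) \<Rightarrow> bool" where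
  "directed D le \<longleftrightarrow>
     D \<noteq> {} \<and>
     (\<forall>i\<in>D. le i i) \<and>
     (\<forall>i\<in>D. \<forall>j\<in>D. \<forall>k\<in>D. le i j \<longrightarrow> le j k \<longrightarrow> le i k) \<and>
     (\<forall>i\<in>D. \<forall>j\<in>D. \<exists>k\<in>D. le i k \<and> le j k)"

definition tail_filter :: "'i set \<Rightarrow> ('i \<Rightarrow> 'i \<Rightarrow> bool) \<Rightarrow> 'i filter" where
  "tail_filter D le = (INF d\<in>D. principal {i\<in>D. le d i})"

lemma eventually_tail_filter:
  assumes "directed D le"
  shows "eventually P (tail_filter D le) \<longleftrightarrow> (\<exists>d\<in>D. \<forall>i\<in>D. le d i \<longrightarrow> P i)"
proof -
  have "eventually P (INF d\<in>D. principal {i\<in>D. le d i}) \<longleftrightarrow>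
        (\<exists>d\<in>D. eventually P (principal {i\<in>D. le d i}))"
  proof (rule eventually_INF_base)
    show "D \<noteq> {}" using assms by (simp add: directed_def)
  next
    fix a b assume ab: "a \<in> D" "b \<in> D"
    then obtain k where k: "k \<in> D" "le a k" "le b k"
      using assms unfolding directed_def by meson
    have "{i\<in>D. le k i} \<subseteq> {i\<in>D. le a i} \<inter> {i\<in>D. le b i}"
      using assms ab k unfolding directed_def by blast
    then show "\<exists>x\<in>D. principal {i\<in>D. le x i} \<le>
        inf (principal {i\<in>D. le a i}) (principal {i\<in>D. le b i})"
      using k(1) by auto
  qed
  then show ?thesis
    by (auto simp: tail_filter_def eventually_principal)
qed

lemma tendsto_tail_filter:
  assumes "directed D le"
  shows "(f \<longlongrightarrow> l) (tail_filter D le) \<longleftrightarrow>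
    (\<forall>U. open U \<longrightarrow> l \<in> U \<longrightarrow> (\<exists>d\<in>D. \<forall>i\<in>D. le d i \<longrightarrow> f i \<in> U))"
  by (simp add: tendsto_def eventually_tail_filter[OF assms])

text \<open>
  HOL cannot quantify over the index types of nets inside a definition.  Up to the filter of
  tails, every net in \<open>'p\<close> is a net indexed by pairs (tail, point of that tail), so nets with
  index type \<open>'p net_index\<close> are enough: the lemmas \<open>Q_cellI\<close>, \<open>P_aaD\<close> and \<open>proximalI\<close> below
  show that the notions defined with this index type cover nets over arbitrary index types.
\<close>

type_synonym 'p net_index = "'p set \<times> 'p"

lemma net_reindex:
  fixes f :: "'i \<Rightarrow> 'p"
  assumes "directed D le"
  obtains D' :: "'p net_index set" and le'
  where "directed D' le'"
    and "snd ` D' \<subseteq> f ` D"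
    and "filtermap snd (tail_filter D' le') = filtermap f (tail_filter D le)"
proof -
  define tl where "tl d = f ` {i\<in>D. le d i}" for d
  define D' where "D' = {(A, p). (\<exists>d\<in>D. A = tl d) \<and> p \<in> A}"
  define le' :: "'p net_index \<Rightarrow> 'p net_index \<Rightarrow> bool" where "le' a b \<longleftrightarrow> fst b \<subseteq> fst a" for a b
  have ne: "D \<noteq> {}" and rf: "\<And>i. i \<in> D \<Longrightarrow> le i i"
    and tr: "\<And>i j k. i \<in> D \<Longrightarrow> j \<in> D \<Longrightarrow> k \<in> D \<Longrightarrow> le i j \<Longrightarrow> le j k \<Longrightarrow> le i k"
    and ub: "\<And>i j. i \<in> D \<Longrightarrow> j \<in> D \<Longrightarrow> \<exists>k\<in>D. le i k \<and> le j k"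
    using assms unfolding directed_def by blast+
  have mem: "(tl d, f i) \<in> D'" if "d \<in> D" "i \<in> D" "le d i" for d i
    using that by (auto simp: D'_def tl_def)
  have mono: "tl k \<subseteq> tl d" if "d \<in> D" "k \<in> D" "le d k" for d k
    using that tr unfolding tl_def by blast
  have dir: "directed D' le'"
    unfolding directed_def
  proof (intro conjI ballI impI)
    show "D' \<noteq> {}" using ne rf mem by blast
    fix a b assume "a \<in> D'" "b \<in> D'"
    then obtain d e where de: "d \<in> D" "e \<in> D" "fst a = tl d" "fst b = tl e"
      by (auto simp: D'_def)
    obtain k where k: "k \<in> D" "le d k" "le e k" using ub de by blast
    have "(tl k, f k) \<in> D'" using mem k rf by blast
    moreover have "le' a (tl k, f k)" "le' b (tl k, f k)"
      using mono de k by (auto simp: le'_def)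
    ultimately show "\<exists>k\<in>D'. le' a k \<and> le' b k" by blast
  qed (auto simp: le'_def)
  have sub: "snd ` D' \<subseteq> f ` D" by (auto simp: D'_def tl_def)
  have "eventually P (filtermap snd (tail_filter D' le')) \<longleftrightarrow>
        eventually P (filtermap f (tail_filter D le))" for P
  proof
    assume "eventually P (filtermap snd (tail_filter D' le'))"
    then obtain a where a: "a \<in> D'" "\<And>b. b \<in> D' \<Longrightarrow> le' a b \<Longrightarrow> P (snd b)"
      by (auto simp: eventually_filtermap eventually_tail_filter[OF dir])
    then obtain d where d: "d \<in> D" "fst a = tl d" by (auto simp: D'_def)
    have "P (f i)" if "i \<in> D" "le d i" for i
      using a(2)[OF mem[OF d(1) that]] d by (auto simp: le'_def)
    then show "eventually P (filtermap f (tail_filter D le))"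
      using d by (auto simp: eventually_filtermap eventually_tail_filter[OF assms])
  next
    assume "eventually P (filtermap f (tail_filter D le))"
    then obtain d where d: "d \<in> D" "\<And>i. i \<in> D \<Longrightarrow> le d i \<Longrightarrow> P (f i)"
      by (auto simp: eventually_filtermap eventually_tail_filter[OF assms])
    have "P (snd b)" if "b \<in> D'" "le' (tl d, f d) b" for b
    proof -
      have "snd b \<in> tl d" using that by (auto simp: D'_def le'_def)
      then show ?thesis using d by (auto simp: tl_def)
    qed
    moreover have "(tl d, f d) \<in> D'" using mem d rf by blast
    ultimately show "eventually P (filtermap snd (tail_filter D' le'))"
      unfolding eventually_filtermap eventually_tail_filter[OF dir] by blast
  qed
  then have "filtermap snd (tail_filter D' le') = filtermap f (tail_filter D le)"
    by (simp add: filter_eq_iff)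
  with dir sub show thesis by (rule that)
qed

lemma tendsto_reindex:
  assumes "filtermap s F = filtermap f G"
  shows "((\<lambda>n. h (s n)) \<longlongrightarrow> l) F \<longleftrightarrow> ((\<lambda>i. h (f i)) \<longlongrightarrow> l) G"
proof -
  have "((\<lambda>n. h (s n)) \<longlongrightarrow> l) F \<longleftrightarrow> (h \<longlongrightarrow> l) (filtermap s F)"
    by (simp add: filterlim_filtermap)
  also have "\<dots> \<longleftrightarrow> ((\<lambda>i. h (f i)) \<longlongrightarrow> l) G"
    by (simp add: assms filterlim_filtermap)
  finally show ?thesis .
qed


subsection \<open>Semiflows\<close>

text \<open>The class \<open>topological_monoid_mult\<close> demands joint continuity of the multiplication.\<close>

definition semiflow ::
  "('t::topological_monoid_mult \<Rightarrow> 'x::topological_space \<Rightarrow> 'x) \<Rightarrow> bool" where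
  "semiflow act \<longleftrightarrow>
     continuous_on UNIV (\<lambda>(t, x). act t x) \<and>
     (\<forall>x. act 1 x = x) \<and>
     (\<forall>t s x. act t (act s x) = act (t * s) x)"

definition orbit :: "('t \<Rightarrow> 'x \<Rightarrow> 'x) \<Rightarrow> 'x \<Rightarrow> 'x set" where
  "orbit act x = range (\<lambda>t. act t x)"

definition minimal :: "('t \<Rightarrow> 'x::topological_space \<Rightarrow> 'x) \<Rightarrow> bool" where
  "minimal act \<longleftrightarrow> (\<forall>x. closure (orbit act x) = UNIV)"

definition invertible_semiflow :: "('t \<Rightarrow> 'x \<Rightarrow> 'x) \<Rightarrow> bool" where
  "invertible_semiflow act \<longleftrightarrow> (\<forall>t. bij (act t))"

text \<open>
  The reflection \<open>xt = t\<^sup>-\<^sup>1x\<close>, with the parameter \<open>t\<close> still written first;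
  \<open>t\<^sup>-\<^sup>1\<close> is the inverse of the transition map (\<open>t\<close> need not be invertible in \<open>T\<close>).
\<close>

definition reflection :: "('t \<Rightarrow> 'x \<Rightarrow> 'x) \<Rightarrow> 't \<Rightarrow> 'x \<Rightarrow> 'x" where
  "reflection act t x = inv (act t) x"


subsection \<open>Dynamical notions\<close>

definition Q_cell :: "('t \<Rightarrow> 'x::topological_space \<Rightarrow> 'x) \<Rightarrow> 'x \<Rightarrow> 'x set" where
  "Q_cell act x = {x'.
     \<exists>(D :: ('t \<times> 'x \<times> 'x) net_index set) le t u u' z.
       directed D le \<and>
       (u \<longlongrightarrow> x) (tail_filter D le) \<and>
       (u' \<longlongrightarrow> x') (tail_filter D le) \<and>
       ((\<lambda>n. act (t n) (u n)) \<longlongrightarrow> z) (tail_filter D le) \<and>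
       ((\<lambda>n. act (t n) (u' n)) \<longlongrightarrow> z) (tail_filter D le)}"

definition P_aa :: "('t \<Rightarrow> 'x::topological_space \<Rightarrow> 'x) \<Rightarrow> 'x set" where
  "P_aa act = {x.
     \<forall>(D :: ('t \<times> 'x) net_index set) le t u' y x'.
       directed D le \<longrightarrow>
       ((\<lambda>n. act (t n) x) \<longlongrightarrow> y) (tail_filter D le) \<longrightarrow>
       (u' \<longlongrightarrow> x') (tail_filter D le) \<longrightarrow>
       (\<forall>n\<in>D. act (t n) (u' n) = y) \<longrightarrow>
       x = x'}"

definition syndetic :: "'t::topological_monoid_mult set \<Rightarrow> bool" where
  "syndetic A \<longleftrightarrow> (\<exists>K. compact K \<and> (\<forall>t. (\<lambda>k. k * t) ` K \<inter> A \<noteq> {}))"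

definition locally_almost_periodic ::
  "('t::topological_monoid_mult \<Rightarrow> 'x::topological_space \<Rightarrow> 'x) \<Rightarrow> 'x \<Rightarrow> bool" where
  "locally_almost_periodic act x \<longleftrightarrow>
     (\<forall>U. open U \<and> x \<in> U \<longrightarrow>
       (\<exists>V A. open V \<and> x \<in> V \<and> syndetic A \<and> (\<forall>a\<in>A. act a ` V \<subseteq> U)))"

definition proximal :: "('t \<Rightarrow> 'x::topological_space \<Rightarrow> 'x) \<Rightarrow> 'x \<Rightarrow> 'x \<Rightarrow> bool" where
  "proximal act x y \<longleftrightarrow>
     (\<exists>(D :: 't net_index set) le t z.
       directed D le \<and>
       ((\<lambda>n. act (t n) x) \<longlongrightarrow> z) (tail_filter D le) \<and>
       ((\<lambda>n. act (t n) y) \<longlongrightarrow> z) (tail_filter D le))"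

definition distal_point :: "('t \<Rightarrow> 'x::topological_space \<Rightarrow> 'x) \<Rightarrow> 'x \<Rightarrow> bool" where
  "distal_point act x \<longleftrightarrow> (\<forall>y \<in> closure (orbit act x). proximal act x y \<longrightarrow> y = x)"


subsection \<open>Independence of the index type\<close>

lemma Q_cellI:
  fixes D :: "'i set" and act :: "'t \<Rightarrow> 'x::topological_space \<Rightarrow> 'x"
  assumes "directed D le"
    and "(u \<longlongrightarrow> x) (tail_filter D le)"
    and "(u' \<longlongrightarrow> x') (tail_filter D le)"
    and "((\<lambda>n. act (t n) (u n)) \<longlongrightarrow> z) (tail_filter D le)"
    and "((\<lambda>n. act (t n) (u' n)) \<longlongrightarrow> z) (tail_filter D le)"
  shows "x' \<in> Q_cell act x"
proof -
  obtain D' :: "('t \<times> 'x \<times> 'x) net_index set" and le' where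
    dir: "directed D' le'" and eq:
    "filtermap snd (tail_filter D' le') = filtermap (\<lambda>n. (t n, u n, u' n)) (tail_filter D le)"
    by (rule net_reindex[OF assms(1), of "\<lambda>n. (t n, u n, u' n)"]) blast
  note r = tendsto_reindex[OF eq]
  show ?thesis
    unfolding Q_cell_def mem_Collect_eq
    apply (rule exI[of _ D'], rule exI[of _ le'], rule exI[of _ "\<lambda>n. fst (snd n)"],
        rule exI[of _ "\<lambda>n. fst (snd (snd n))"], rule exI[of _ "\<lambda>n. snd (snd (snd n))"],
        rule exI[of _ z])
    using dir assms r[of "\<lambda>p. fst (snd p)" x] r[of "\<lambda>p. snd (snd p)" x']
      r[of "\<lambda>p. act (fst p) (fst (snd p))" z] r[of "\<lambda>p. act (fst p) (snd (snd p))" z]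
    by simp
qed

lemma P_aaD:
  fixes D :: "'i set" and act :: "'t \<Rightarrow> 'x::topological_space \<Rightarrow> 'x"
  assumes "x \<in> P_aa act"
    and "directed D le"
    and "((\<lambda>n. act (t n) x) \<longlongrightarrow> y) (tail_filter D le)"
    and "(u' \<longlongrightarrow> x') (tail_filter D le)"
    and "\<And>n. n \<in> D \<Longrightarrow> act (t n) (u' n) = y"
  shows "x = x'"
proof -
  obtain D' :: "('t \<times> 'x) net_index set" and le' where
    dir: "directed D' le'" and sub: "snd ` D' \<subseteq> (\<lambda>n. (t n, u' n)) ` D" and eq:
    "filtermap snd (tail_filter D' le') = filtermap (\<lambda>n. (t n, u' n)) (tail_filter D le)"
    by (rule net_reindex[OF assms(2), of "\<lambda>n. (t n, u' n)"]) blast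
  note r = tendsto_reindex[OF eq]
  have "((\<lambda>n. act (fst (snd n)) x) \<longlongrightarrow> y) (tail_filter D' le')"
    using r[of "\<lambda>p. act (fst p) x" y] assms(3) by simp
  moreover have "((\<lambda>n. snd (snd n)) \<longlongrightarrow> x') (tail_filter D' le')"
    using r[of snd x'] assms(4) by simp
  moreover have "\<forall>n\<in>D'. act (fst (snd n)) (snd (snd n)) = y"
  proof
    fix n assume "n \<in> D'"
    then obtain i where "i \<in> D" "snd n = (t i, u' i)" using sub by blast
    then show "act (fst (snd n)) (snd (snd n)) = y" using assms(5) by simp
  qed
  ultimately show ?thesis
    using assms(1)[unfolded P_aa_def mem_Collect_eq, rule_format,
        OF dir, of "\<lambda>n. fst (snd n)" y "\<lambda>n. snd (snd n)" x'] by simp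
qed

lemma proximalI:
  fixes D :: "'i set" and act :: "'t \<Rightarrow> 'x::topological_space \<Rightarrow> 'x"
  assumes "directed D le"
    and "((\<lambda>n. act (t n) x) \<longlongrightarrow> z) (tail_filter D le)"
    and "((\<lambda>n. act (t n) y) \<longlongrightarrow> z) (tail_filter D le)"
  shows "proximal act x y"
proof -
  obtain D' :: "'t net_index set" and le' where
    dir: "directed D' le'" and eq:
    "filtermap snd (tail_filter D' le') = filtermap t (tail_filter D le)"
    by (rule net_reindex[OF assms(1), of t]) blast
  note r = tendsto_reindex[OF eq]
  show ?thesis
    unfolding proximal_def
    using dir assms r[of "\<lambda>s. act s x" z] r[of "\<lambda>s. act s y" z] by blast
qed

end

theory Submission
  imports Defs
begin

text \<open>
  Everything is routed through almost automorphy (aa), which (1) implies because constant nets are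
  admissible in \<open>Q\<close>.  The main step is Veech's: if \<open>x\<close> is aa, then for every
  neighbourhood \<open>U\<close> of \<open>x\<close> there is a neighbourhood \<open>V\<close> of \<open>x\<close> such that \<open>sx, tx \<in> V\<close> forces
  \<open>s\<^sup>-\<^sup>1tx \<in> U\<close>.  Since \<open>T\<close> is abelian and orbits are dense, transitions may be replaced by products of
  transitions and their inverses here, and one gets that \<open>sx \<in> V\<close> forces \<open>sV \<subseteq> U\<close> and
  \<open>s\<^sup>-\<^sup>1V \<subseteq> U\<close>.  This gives (1), (3) and (b).  Conversely, (3) gives (b): if \<open>t\<^sup>-\<^sup>1x \<rightarrow> y\<close> and
  \<open>ty \<rightarrow> x'\<close>, then local almost periodicity makes \<open>x\<close> and \<open>x'\<close> proximal.  The reflection is again a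
  minimal invertible semiflow, whose reflection is the given one, so all of this may be dualised.
\<close>

section \<open>Closures and nets\<close>

text \<open>Tube lemma: over a point outside the projection, the open complement of \<open>C\<close>
  contains a whole box \<open>N \<times> K\<close>. Compactness of \<open>X\<close>, or of the set
  \<open>K\<close> witnessing syndeticity, is exploited through this.\<close>

lemma closed_projection_compact:
  fixes C :: "('a::topological_space \<times> 'b::topological_space) set"
  assumes "compact K" and "closed C"
  shows "closed {x. \<exists>k\<in>K. (x, k) \<in> C}"
  unfolding closed_def
proof (rule Topological_Spaces.openI)
  fix x assume "x \<in> - {x. \<exists>k\<in>K. (x, k) \<in> C}"
  then have "{x} \<times> K \<subseteq> - C" by auto
  with assms obtain N where "x \<in> N" "open N" "N \<times> K \<subseteq> - C"
    using Elementary_Topology.tube_lemma[of K "- C" x] by (auto simp: open_Compl)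
  then show "\<exists>N. open N \<and> x \<in> N \<and> N \<subseteq> - {x. \<exists>k\<in>K. (x, k) \<in> C}"
    by (intro exI[of _ N]) auto
qed

lemma eventually_tail_filterI:
  assumes "directed D le" and "\<And>n. n \<in> D \<Longrightarrow> P n"
  shows "eventually P (tail_filter D le)"
  using assms(1) unfolding eventually_tail_filter[OF assms(1)] directed_def
  by (meson all_not_in_conv assms(2))

lemma tail_filter_neq_bot:
  assumes "directed D le"
  shows "tail_filter D le \<noteq> bot"
proof
  assume "tail_filter D le = bot"
  then have "\<exists>d\<in>D. \<forall>i\<in>D. le d i \<longrightarrow> False"
    unfolding eventually_tail_filter[OF assms, symmetric] by simp
  moreover have "\<forall>i\<in>D. le i i" by (rule assms[unfolded directed_def, THEN conjunct2, THEN conjunct1])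
  ultimately show False by blast
qed

lemma net_limit_in_closure:
  assumes "directed D le" and "(f \<longlongrightarrow> p) (tail_filter D le)" and "\<And>n. n \<in> D \<Longrightarrow> f n \<in> S"
  shows "p \<in> closure S"
proof (rule Lim_in_closed_set[OF closed_closure _ tail_filter_neq_bot[OF assms(1)] assms(2)])
  show "\<forall>\<^sub>F n in tail_filter D le. f n \<in> closure S"
    by (rule eventually_tail_filterI[OF assms(1)]) (rule subsetD[OF closure_subset assms(3)])
qed

text \<open>The index set consists of pairs (neighbourhood of \<open>p\<close>, index with value in
  it) under reverse inclusion; it is directed because the range meets every intersection of two
  neighbourhoods.\<close>

lemma in_closure_obtains_net:
  fixes f :: "'i \<Rightarrow> 'p::topological_space"
  assumes "p \<in> closure (range f)"
  obtains D :: "('p set \<times> 'i) set" and le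
  where "directed D le" and "((\<lambda>n. f (snd n)) \<longlongrightarrow> p) (tail_filter D le)"
proof -
  define D where "D = {(P, i). open P \<and> p \<in> P \<and> f i \<in> P}"
  define le :: "'p set \<times> 'i \<Rightarrow> 'p set \<times> 'i \<Rightarrow> bool" where "le a b \<longleftrightarrow> fst b \<subseteq> fst a" for a b
  have ex: "\<exists>i. (P, i) \<in> D" if "open P" "p \<in> P" for P
    using assms that unfolding closure_iff_nhds_not_empty D_def by blast
  have dir: "directed D le"
    unfolding directed_def
  proof (intro conjI ballI impI)
    show "D \<noteq> {}" using ex[of UNIV] by auto
    fix a b assume "a \<in> D" "b \<in> D"
    then have "open (fst a \<inter> fst b)" "p \<in> fst a \<inter> fst b" by (auto simp: D_def)
    from ex[OF this] obtain i where "(fst a \<inter> fst b, i) \<in> D" ..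
    then show "\<exists>k\<in>D. le a k \<and> le b k" by (rule bexI[rotated]) (simp add: le_def)
  qed (auto simp: le_def)
  moreover have "((\<lambda>n. f (snd n)) \<longlongrightarrow> p) (tail_filter D le)"
    unfolding tendsto_tail_filter[OF dir]
  proof (intro allI impI)
    fix U assume "open U" "p \<in> U"
    from ex[OF this] obtain i where "(U, i) \<in> D" by blast
    then show "\<exists>d\<in>D. \<forall>i\<in>D. le d i \<longrightarrow> f (snd i) \<in> U"
      by (intro bexI[of _ "(U, i)"]) (auto simp: D_def le_def)
  qed
  ultimately show thesis by (rule that)
qed

text \<open>Trades nets for the closure of one set, from which a single \<open>t\<close> close to
  the limit can be picked.\<close>

lemma proximal_iff_closure:
  "proximal act x y \<longleftrightarrow> (\<exists>z. (z, z) \<in> closure (range (\<lambda>t. (act t x, act t y))))"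
proof
  assume "proximal act x y"
  then obtain D :: "'a net_index set" and le t z where D: "directed D le"
    and lim: "((\<lambda>n. act (t n) x) \<longlongrightarrow> z) (tail_filter D le)"
      "((\<lambda>n. act (t n) y) \<longlongrightarrow> z) (tail_filter D le)"
    unfolding proximal_def by blast
  show "\<exists>z. (z, z) \<in> closure (range (\<lambda>t. (act t x, act t y)))"
    by (rule exI[of _ z], rule net_limit_in_closure[OF D tendsto_Pair[OF lim]]) auto
next
  assume "\<exists>z. (z, z) \<in> closure (range (\<lambda>t. (act t x, act t y)))"
  then obtain z where "(z, z) \<in> closure (range (\<lambda>t. (act t x, act t y)))" ..
  from in_closure_obtains_net[OF this]
  obtain D :: "(('b \<times> 'b) set \<times> 'a) set" and le where D: "directed D le" and
    lim: "((\<lambda>n. (act (snd n) x, act (snd n) y)) \<longlongrightarrow> (z, z)) (tail_filter D le)" .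
  show "proximal act x y"
    using proximalI[OF D, of act snd x z y] tendsto_fst[OF lim] tendsto_snd[OF lim] by simp
qed

lemma Q_cellE:
  fixes act :: "'t \<Rightarrow> 'x::topological_space \<Rightarrow> 'x"
  assumes "x' \<in> Q_cell act x"
  obtains z where "(x, x', z, z) \<in> closure (range (\<lambda>(t, u, u'). (u, u', act t u, act t u')))"
proof -
  from assms obtain D :: "('t \<times> 'x \<times> 'x) net_index set" and le t u u' z where D: "directed D le"
    and lim: "(u \<longlongrightarrow> x) (tail_filter D le)" "(u' \<longlongrightarrow> x') (tail_filter D le)"
      "((\<lambda>n. act (t n) (u n)) \<longlongrightarrow> z) (tail_filter D le)"
      "((\<lambda>n. act (t n) (u' n)) \<longlongrightarrow> z) (tail_filter D le)"
    unfolding Q_cell_def mem_Collect_eq by (elim exE conjE)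
  have mem: "(u n, u' n, act (t n) (u n), act (t n) (u' n))
      \<in> range (\<lambda>(t, u, u'). (u, u', act t u, act t u'))" for n
    by (rule range_eqI[of _ _ "(t n, u n, u' n)"]) simp
  have "((\<lambda>n. (u n, u' n, act (t n) (u n), act (t n) (u' n))) \<longlongrightarrow> (x, x', z, z)) (tail_filter D le)"
    by (intro tendsto_Pair lim)
  from net_limit_in_closure[OF D this mem] show thesis by (rule that)
qed

lemma closure_pairE:
  assumes "(a, b) \<in> closure (range f)" and "open A" and "a \<in> A" and "open B" and "b \<in> B"
  obtains t where "f t \<in> A \<times> B"
proof -
  have "A \<times> B \<inter> closure (range f) \<noteq> {}" using assms(1,3,5) by auto
  then have "A \<times> B \<inter> range f \<noteq> {}"
    using open_Int_closure_eq_empty[OF open_Times[OF assms(2,4)], of "range f"] by simp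
  then obtain p where p: "p \<in> A \<times> B" "p \<in> range f" by (meson disjoint_iff)
  from p(2) obtain t where "p = f t" ..
  with p(1) have "f t \<in> A \<times> B" by (simp only:)
  then show thesis by (rule that)
qed

section \<open>The semiflow and its reflection\<close>

text \<open>The hypotheses form a locale so that it can be interpreted a second time at the
  reflection, which dualises every result proved in it.\<close>

locale minimal_invertible_semiflow =
  fixes act :: "'t::topological_comm_monoid_mult \<Rightarrow> 'x::t2_space \<Rightarrow> 'x"
  assumes compact_space: "compact (UNIV :: 'x set)"
    and semiflow: "semiflow act"
    and minimal: "minimal act"
    and invertible: "invertible_semiflow act"
begin

abbreviation refl_act :: "'t \<Rightarrow> 'x \<Rightarrow> 'x" where
  "refl_act \<equiv> reflection act"

lemma bij_act: "bij (act t)"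
  using invertible by (simp add: invertible_semiflow_def)

lemma act_one [simp]: "act 1 x = x"
  and act_mult: "act (t * s) x = act t (act s x)"
  using semiflow by (auto simp: semiflow_def)

lemma refl_act_act [simp]: "refl_act t (act t x) = x"
  using bij_act[of t] by (simp add: reflection_def bij_is_inj)

lemma act_refl_act [simp]: "act t (refl_act t x) = x"
  using bij_act[of t] by (simp add: reflection_def bij_is_surj surj_f_inv_f)

lemma act_commute: "act t (act s x) = act s (act t x)"
  by (metis act_mult mult.commute)

lemma refl_act_act_commute: "refl_act s (act t x) = act t (refl_act s x)"
  by (metis act_commute act_refl_act refl_act_act)

lemma refl_act_mult: "refl_act (t * s) x = refl_act t (refl_act s x)"
  by (metis act_mult act_refl_act mult.commute refl_act_act)

lemma refl_act_one [simp]: "refl_act 1 x = x"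
  by (metis act_one refl_act_act)

lemma continuous_act: "continuous_on UNIV (\<lambda>(t, x). act t x)"
  using semiflow by (simp add: semiflow_def)

lemma continuous_on_act [continuous_intros]:
  assumes "continuous_on S f" and "continuous_on S g"
  shows "continuous_on S (\<lambda>z. act (f z) (g z))"
  using continuous_on_compose2[OF continuous_act continuous_on_Pair[OF assms]] by simp

text \<open>The graph of \<open>(t, x) \<mapsto> t\<^sup>-\<^sup>1x\<close> is closed and \<open>X\<close> is compact.\<close>

lemma continuous_refl_act: "continuous_on UNIV (\<lambda>(t, x). refl_act t x)"
  unfolding continuous_on_closed_vimage[OF closed_UNIV]
proof (intro allI impI)
  fix B :: "'x set" assume "closed B"
  then have "compact B" using compact_space compact_Int_closed by (metis inf_top_left)
  moreover have "closed {p. act (fst (fst p)) (snd p) = snd (fst p)}"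
    by (intro closed_Collect_eq continuous_intros)
  ultimately have "closed {q. \<exists>y\<in>B. (q, y) \<in> {p. act (fst (fst p)) (snd p) = snd (fst p)}}"
    by (rule closed_projection_compact)
  also have "{q. \<exists>y\<in>B. (q, y) \<in> {p. act (fst (fst p)) (snd p) = snd (fst p)}}
      = (\<lambda>(t, x). refl_act t x) -` B \<inter> UNIV"
    by auto (metis act_refl_act)
  finally show "closed ((\<lambda>(t, x). refl_act t x) -` B \<inter> UNIV)" .
qed

lemma orbit_meets:
  assumes "open U" and "U \<noteq> {}"
  obtains t where "act t x \<in> U"
proof -
  from assms obtain z where "z \<in> U" by blast
  moreover have "z \<in> closure (orbit act x)" using minimal by (simp add: minimal_def)
  ultimately show thesis
    using assms(1) that unfolding closure_iff_nhds_not_empty orbit_def by blast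
qed

lemma orbit_enters_nhd:
  assumes "open U" and "x \<in> U"
  obtains t where "act t z \<in> U"
  using orbit_meets[OF assms(1)] assms(2) by (metis empty_iff)

lemma minimal_closed:
  assumes "closed C" and "C \<noteq> {}" and "\<And>t. act t ` C \<subseteq> C"
  shows "C = UNIV"
proof -
  from assms obtain x where "x \<in> C" by blast
  then have "orbit act x \<subseteq> C" using assms(3) by (auto simp: orbit_def)
  then have "closure (orbit act x) \<subseteq> C" using assms(1) by (simp add: closure_minimal)
  then show ?thesis using minimal by (auto simp: minimal_def)
qed

lemma open_vimage_act: "open U \<Longrightarrow> open (act t -` U)"
  by (intro open_vimage continuous_intros)

lemma continuous_on_refl_act [continuous_intros]:
  assumes "continuous_on S f" and "continuous_on S g"
  shows "continuous_on S (\<lambda>z. refl_act (f z) (g z))"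
  using continuous_on_compose2[OF continuous_refl_act continuous_on_Pair[OF assms]] by simp

lemma open_vimage_refl_act: "open U \<Longrightarrow> open (refl_act t -` U)"
  by (intro open_vimage continuous_intros)

text \<open>
  For a closed \<open>T\<^sup>-\<^sup>1\<close>-invariant set \<open>C\<close>, the intersection of all \<open>t\<^sup>-\<^sup>1C\<close> is nonempty by
  compactness and \<open>T\<close>-invariant.
\<close>

lemma minimal_refl_act: "minimal refl_act"
  unfolding minimal_def
proof
  fix x
  define C where "C = closure (orbit refl_act x)"
  have clC: "closed C" and orb: "orbit refl_act x \<subseteq> C"
    by (simp_all add: C_def closure_subset)
  have inv: "refl_act t y \<in> C" if "y \<in> C" for t y
  proof -
    have "refl_act t ` orbit refl_act x \<subseteq> orbit refl_act x"
      by (auto simp: orbit_def refl_act_mult[symmetric])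
    then have "refl_act t ` closure (orbit refl_act x) \<subseteq> C"
      using orb by (intro image_closure_subset clC continuous_intros) auto
    with that show ?thesis unfolding C_def by blast
  qed
  have "x \<in> C"
    using orb by (rule subsetD) (auto simp: orbit_def intro: range_eqI[of _ _ 1])
  define I where "I = (\<Inter>t. act t -` C)"
  have "UNIV \<inter> I \<noteq> {}"
    unfolding I_def
  proof (rule compact_imp_fip_image[OF compact_space])
    show "closed (act t -` C)" for t
      by (intro closed_vimage clC continuous_intros)
    fix J :: "'t set" assume "finite J"
    \<comment> \<open>The factor \<open>t\<close> of the product cancels, leaving a point of the
      \<open>refl_act\<close>-orbit of \<open>x\<close>; so one point serves all \<open>t\<close> in
      \<open>J\<close>.\<close>
    have "act t (refl_act (\<Prod>J) x) \<in> C" if "t \<in> J" for t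
    proof -
      have "\<Prod>J = t * \<Prod>(J - {t})" using \<open>finite J\<close> that by (rule prod.remove)
      then show ?thesis using inv[OF \<open>x \<in> C\<close>] by (simp add: refl_act_mult)
    qed
    then show "UNIV \<inter> (\<Inter>t\<in>J. act t -` C) \<noteq> {}" by blast
  qed
  moreover have "closed I"
    unfolding I_def by (intro closed_INT ballI closed_vimage clC continuous_intros)
  moreover have "act t ` I \<subseteq> I" for t
    by (auto simp: I_def act_mult[symmetric])
  ultimately have "I = UNIV" using minimal_closed by blast
  moreover have "I \<subseteq> act 1 -` C" unfolding I_def by blast
  ultimately show "closure (orbit refl_act x) = UNIV" by (auto simp: C_def[symmetric])
qed

lemma reflection_minimal_invertible: "minimal_invertible_semiflow refl_act"
proof
  show "semiflow refl_act"
    unfolding semiflow_def using continuous_refl_act by (simp add: refl_act_mult)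
  show "invertible_semiflow refl_act"
    unfolding invertible_semiflow_def reflection_def using bij_act bij_imp_bij_inv by blast
qed (simp_all add: compact_space minimal_refl_act)

lemma reflection_reflection: "reflection refl_act = act"
  by (simp add: reflection_def[abs_def] bij_act inv_inv_eq)

lemma regular_nhds:
  fixes x :: 'x
  assumes "open U" and "x \<in> U"
  obtains V where "open V" and "x \<in> V" and "closure V \<subseteq> U"
proof -
  have "Hausdorff_space (euclidean :: 'x topology)"
    unfolding Hausdorff_space_def disjnt_def
  proof (intro allI impI)
    fix a b :: 'x assume "a \<in> topspace euclidean \<and> b \<in> topspace euclidean \<and> a \<noteq> b"
    then obtain A B where "open A" "open B" "a \<in> A" "b \<in> B" "A \<inter> B = {}"
      using hausdorff[of a b] by blast
    then show "\<exists>A B. openin euclidean A \<and> openin euclidean B \<and> a \<in> A \<and> b \<in> B \<and> A \<inter> B = {}"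
      by (intro exI[of _ A] exI[of _ B]) simp
  qed
  then have "regular_space (euclidean :: 'x topology)"
    by (intro compact_Hausdorff_imp_regular_space) (simp_all add: compact_space_def compact_space)
  from this[unfolded regular_space, rule_format, of "- U" x]
  obtain V where V: "open V" "x \<in> V" "disjnt (- U) (closure V)"
    using assms by (auto simp: closed_Compl)
  from V(3) have "closure V \<subseteq> U" by (auto simp: disjnt_iff)
  with V(1,2) show thesis by (rule that)
qed

text \<open>By minimality the preimages of \<open>V\<close> under the transitions cover
  \<open>X\<close>; the parameters of a finite subcover form the compact set.\<close>

lemma syndetic_return_times:
  assumes "open V" and "x \<in> V"
  shows "syndetic {t. act t z \<in> V}"
proof -
  have "UNIV \<subseteq> (\<Union>t. act t -` V)"
  proof
    fix w obtain t where "act t w \<in> V" by (rule orbit_enters_nhd[OF assms])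
    then show "w \<in> (\<Union>t. act t -` V)" by blast
  qed
  then obtain K where K: "finite K" "UNIV \<subseteq> (\<Union>t\<in>K. act t -` V)"
    by (rule compactE_image[OF compact_space open_vimage_act[OF assms(1)]])
  have "(\<lambda>k. k * t) ` K \<inter> {t. act t z \<in> V} \<noteq> {}" for t
  proof -
    obtain k where "k \<in> K" "act (k * t) z \<in> V"
      using subsetD[OF K(2), of "act t z"] by (auto simp: act_mult)
    then show ?thesis by blast
  qed
  then show ?thesis
    unfolding syndetic_def using finite_imp_compact[OF K(1)] by (intro exI[of _ K]) simp
qed

section \<open>Almost automorphy and quotients of return times\<close>

text \<open>Transitions are bijective, so \<open>act (t n) (u' n) = y\<close> forces
  \<open>u' n = refl_act (t n) y\<close>. Almost automorphy thus concerns only the limits of the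
  pairs (tx, t^-1 y) whose first coordinate is \<open>y\<close> itself.\<close>

lemma P_aaI:
  assumes "\<And>y x'. (y, x') \<in> closure (range (\<lambda>t. (act t x, refl_act t y))) \<Longrightarrow> x = x'"
  shows "x \<in> P_aa act"
  unfolding P_aa_def mem_Collect_eq
proof (intro allI impI)
  fix D :: "('t \<times> 'x) net_index set" and le t u' y x'
  assume D: "directed D le" and t: "((\<lambda>n. act (t n) x) \<longlongrightarrow> y) (tail_filter D le)"
    and u': "(u' \<longlongrightarrow> x') (tail_filter D le)" and eq: "\<forall>n\<in>D. act (t n) (u' n) = y"
  have "u' n = refl_act (t n) y" if "n \<in> D" for n
    using eq that refl_act_act by metis
  then have "(act (t n) x, u' n) \<in> range (\<lambda>t. (act t x, refl_act t y))" if "n \<in> D" for n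
    using that by blast
  from net_limit_in_closure[OF D tendsto_Pair[OF t u'] this] show "x = x'" by (rule assms)
qed

lemma P_aa_closure_eq:
  assumes "x \<in> P_aa act" and "(y, x') \<in> closure (range (\<lambda>t. (act t x, refl_act t y)))"
  shows "x = x'"
proof -
  from in_closure_obtains_net[OF assms(2)]
  obtain D :: "(('x \<times> 'x) set \<times> 't) set" and le where D: "directed D le" and
    lim: "((\<lambda>n. (act (snd n) x, refl_act (snd n) y)) \<longlongrightarrow> (y, x')) (tail_filter D le)" .
  show ?thesis
    using P_aaD[OF assms(1) D, of snd y "\<lambda>n. refl_act (snd n) y" x']
      tendsto_fst[OF lim] tendsto_snd[OF lim] by simp
qed

text \<open>The section of \<open>C\<close> over \<open>y\<close> is contained in
  \<open>{x}\<close>, hence misses the compact set \<open>- U\<close>; by the tube lemma so do the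
  sections over all points near \<open>y\<close>.\<close>

lemma P_aa_nhds:
  assumes "x \<in> P_aa act" and "open U" and "x \<in> U"
  obtains N where "open N" and "y \<in> N" and "\<And>t. act t x \<in> N \<Longrightarrow> refl_act t y \<in> U"
proof -
  define C where "C = closure (range (\<lambda>t. (act t x, refl_act t y)))"
  define N where "N = - {w. \<exists>x'\<in>- U. (w, x') \<in> C}"
  have "compact (- U)" using compact_space assms(2) by (metis closed_Compl compact_Int_closed inf_top_left)
  then have "open N" unfolding N_def C_def
    by (intro open_Compl closed_projection_compact) auto
  moreover have "y \<in> N"
    using P_aa_closure_eq[OF assms(1)] assms(3) by (auto simp: N_def C_def)
  moreover have "refl_act t y \<in> U" if "act t x \<in> N" for t
  proof -
    have "(act t x, refl_act t y) \<in> C"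
      unfolding C_def by (intro subsetD[OF closure_subset]) auto
    then show ?thesis using that by (auto simp: N_def)
  qed
  ultimately show thesis by (rule that)
qed

text \<open>
  Veech's argument.  If the conclusion fails, one chooses \<open>b\<^sub>n\<close> in \<open>T\<close> and shrinking open sets \<open>C\<^sub>n\<close>
  such that \<open>b\<^sub>nx \<in> C\<^sub>n\<close> and \<open>b\<^sub>n\<^sup>-\<^sup>1C\<^sub>n\<^sub>+\<^sub>1\<close> avoids a fixed neighbourhood of \<open>x\<close>.  A cluster point
  \<open>y\<close> of \<open>b\<^sub>nx\<close> then contradicts almost automorphy.
\<close>

lemma P_aa_quotients:
  assumes "x \<in> P_aa act" and "open U" and "x \<in> U"
  shows "\<exists>V. open V \<and> x \<in> V \<and>
    (\<forall>s t. act s x \<in> V \<longrightarrow> act t x \<in> V \<longrightarrow> refl_act s (act t x) \<in> U)"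
proof (rule ccontr)
  assume none: "\<not> ?thesis"
  then have fail: "\<exists>s t. act s x \<in> V \<and> act t x \<in> V \<and> refl_act s (act t x) \<notin> U"
    if "open V" "x \<in> V" for V
    using that by blast
  obtain U' where U': "open U'" "x \<in> U'" "closure U' \<subseteq> U"
    using regular_nhds[OF assms(2,3)] .
  define W where "W = - closure U'"
  have "W \<subseteq> - U'" using closure_subset[of U'] by (auto simp: W_def)
  then have clW: "closure W \<subseteq> - U'"
    using U'(1) by (intro closure_minimal) (simp_all add: closed_Compl)
  have "open W" by (simp add: W_def open_Compl)
  define step where "step C b C' \<longleftrightarrow> C' \<subseteq> C \<and> act b x \<in> C \<and> C' \<subseteq> refl_act b -` W" for C b C'
  have "\<exists>C. \<forall>n. (open (C n) \<and> C n \<noteq> {}) \<and> (\<exists>b. step (C n) b (C (Suc n)))"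
  proof (rule dependent_nat_choice)
    fix C :: "'x set" assume C: "open C \<and> C \<noteq> {}"
    then obtain p where p: "act p x \<in> C" using orbit_meets by blast
    \<comment> \<open>The failure is applied to the preimage of \<open>C\<close> under
      \<open>p\<close>, a neighbourhood of \<open>x\<close>. With b = ps, the point ptx of
      \<open>C\<close> is sent by b^-1 to s^-1 tx in \<open>W\<close>, so \<open>C'\<close> below is
      nonempty.\<close>
    obtain s t where st: "act p (act s x) \<in> C" "act p (act t x) \<in> C" "refl_act s (act t x) \<in> W"
      using fail[of "act p -` C"] C p U'(3) open_vimage_act by (auto simp: W_def)
    define C' where "C' = C \<inter> refl_act (p * s) -` W"
    have "act p (act t x) \<in> C'"
      using st by (simp add: C'_def refl_act_mult refl_act_act_commute[of s])
    then have "open C' \<and> C' \<noteq> {}"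
      using C \<open>open W\<close> open_vimage_refl_act by (auto simp: C'_def)
    moreover have "step C (p * s) C'" using st by (auto simp: step_def C'_def act_mult)
    ultimately show "\<exists>C'. (open C' \<and> C' \<noteq> {}) \<and> (\<exists>b. step C b C')" by blast
  qed auto
  then obtain C b where step: "\<And>n. step (C n) (b n) (C (Suc n))" by metis
  have "C (Suc n) \<subseteq> C n" for n using step[of n] by (simp add: step_def)
  then have anti: "C n \<subseteq> C m" if "m \<le> n" for m n
    using that by (rule lift_Suc_antimono_le)
  define F where "F k = closure ((\<lambda>l. act (b l) x) ` {k..})" for k
  have "UNIV \<inter> (\<Inter>k. F k) \<noteq> {}"
  proof (rule compact_imp_fip_image[OF compact_space])
    fix J :: "nat set" assume "finite J"
    then obtain m where m: "\<forall>k\<in>J. k \<le> m" unfolding finite_nat_set_iff_bounded_le ..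
    have "act (b m) x \<in> F k" if "k \<in> J" for k
    proof -
      have "act (b m) x \<in> (\<lambda>l. act (b l) x) ` {k..}" using m that by simp
      then show ?thesis unfolding F_def by (rule subsetD[OF closure_subset])
    qed
    then have "act (b m) x \<in> UNIV \<inter> (\<Inter>k\<in>J. F k)" by simp
    then show "UNIV \<inter> (\<Inter>k\<in>J. F k) \<noteq> {}" by (metis empty_iff)
  qed (simp add: F_def)
  then obtain y where "y \<in> UNIV \<inter> (\<Inter>k. F k)" by (meson ex_in_conv)
  then have y: "y \<in> F k" for k by simp
  obtain N where N: "open N" "y \<in> N" "\<And>t. act t x \<in> N \<Longrightarrow> refl_act t y \<in> U'"
    using P_aa_nhds[OF assms(1) U'(1,2)] by blast
  obtain n where "act (b n) x \<in> N"
    using y[of 0] N(1,2) unfolding F_def closure_iff_nhds_not_empty by blast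
  then have "refl_act (b n) y \<in> U'" by (rule N(3))
  moreover have "refl_act (b n) y \<in> closure W"
  proof -
    \<comment> \<open>Only indices above \<open>n\<close> are taken, since
      \<open>refl_act (b n)\<close> is known to map into \<open>W\<close> on
      \<open>C (Suc n)\<close> but not on \<open>C n\<close>. The cluster point \<open>y\<close>
      lies in the closure of this tail as well.\<close>
    have "act (b l) x \<in> C (Suc n)" if "Suc n \<le> l" for l
      using anti[OF that] step[of l] by (auto simp: step_def)
    then have "(\<lambda>l. act (b l) x) ` {Suc n..} \<subseteq> refl_act (b n) -` closure W"
      using step[of n] closure_subset[of W] by (force simp: step_def)
    moreover have "closed (refl_act (b n) -` closure W)"
      by (intro closed_vimage closed_closure continuous_intros)
    ultimately have "F (Suc n) \<subseteq> refl_act (b n) -` closure W"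
      unfolding F_def by (rule closure_minimal)
    then show ?thesis using y by blast
  qed
  ultimately show False using clW by blast
qed

section \<open>From quotients to uniform control along return times\<close>

text \<open>Approximate s^-1 x by hx so closely that hx and shx both lie in \<open>V\<close>; this
  is possible since s(s^-1 x) = x. The quotient h^-1(shx) is sx.\<close>

lemma P_aa_inverse_return:
  assumes "x \<in> P_aa act" and "open U" and "x \<in> U"
  shows "\<exists>V. open V \<and> x \<in> V \<and> (\<forall>s. refl_act s x \<in> V \<longrightarrow> act s x \<in> U)"
proof -
  obtain V where V: "open V" "x \<in> V"
    "\<And>s t. act s x \<in> V \<Longrightarrow> act t x \<in> V \<Longrightarrow> refl_act s (act t x) \<in> U"
    using P_aa_quotients[OF assms] by blast
  have "act s x \<in> U" if "refl_act s x \<in> V" for s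
  proof -
    have "open (V \<inter> act s -` V)" "refl_act s x \<in> V \<inter> act s -` V"
      using V that open_vimage_act by auto
    then obtain h where "act h x \<in> V \<inter> act s -` V" by (rule orbit_enters_nhd)
    then show ?thesis using V(3)[of h "s * h"] by (simp add: act_mult act_commute[of s])
  qed
  with V(1,2) show ?thesis by blast
qed

text \<open>A product is turned into a quotient: sx near \<open>x\<close> gives s^-1 x near
  \<open>x\<close>. If hx approximates s^-1 x, then sthx approximates tx, and h^-1(sthx) =
  stx.\<close>

lemma P_aa_products:
  assumes "x \<in> P_aa act" and "open U" and "x \<in> U"
  obtains V where "open V" and "x \<in> V"
    and "\<And>s t. act s x \<in> V \<Longrightarrow> act t x \<in> V \<Longrightarrow> act s (act t x) \<in> U"
proof -
  obtain V where V: "open V" "x \<in> V"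
    "\<And>s t. act s x \<in> V \<Longrightarrow> act t x \<in> V \<Longrightarrow> refl_act s (act t x) \<in> U"
    using P_aa_quotients[OF assms] by blast
  obtain V' where V': "open V'" "x \<in> V'"
    "\<And>s t. act s x \<in> V' \<Longrightarrow> act t x \<in> V' \<Longrightarrow> refl_act s (act t x) \<in> V"
    using P_aa_quotients[OF assms(1) V(1,2)] by blast
  have "act s (act t x) \<in> U" if s: "act s x \<in> V'" and t: "act t x \<in> V \<inter> V'" for s t
  proof -
    have "refl_act s x \<in> V" using V'(3)[of s 1] s V'(2) by simp
    then have "refl_act s x \<in> V \<inter> (\<lambda>z. act s (act t z)) -` V"
      using t by (simp add: act_commute[of s])
    moreover have "open (V \<inter> (\<lambda>z. act s (act t z)) -` V)"
      by (intro open_Int open_vimage V(1) continuous_intros)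
    ultimately obtain h where "act h x \<in> V \<inter> (\<lambda>z. act s (act t z)) -` V"
      using orbit_enters_nhd by blast
    then show ?thesis
      using V(3)[of h "s * (t * h)"]
      by (simp add: act_mult refl_act_act_commute)
  qed
  with V V' show thesis by (intro that[of "V \<inter> V'"]) auto
qed

text \<open>For \<open>v\<close> in the orbit of \<open>x\<close> this is control of products and
  quotients. Density of the orbit and continuity of each transition extend it to all
  \<open>v\<close> in \<open>V\<close>, at the cost of passing from \<open>U'\<close> to its
  closure.\<close>

lemma P_aa_equicontinuous_returns:
  assumes "x \<in> P_aa act" and "open U" and "x \<in> U"
  shows "\<exists>V. open V \<and> x \<in> V \<and>
    (\<forall>s v. act s x \<in> V \<longrightarrow> v \<in> V \<longrightarrow> act s v \<in> U \<and> refl_act s v \<in> U)"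
proof -
  obtain U' where U': "open U'" "x \<in> U'" "closure U' \<subseteq> U"
    using regular_nhds[OF assms(2,3)] .
  obtain V1 where V1: "open V1" "x \<in> V1"
    "\<And>s t. act s x \<in> V1 \<Longrightarrow> act t x \<in> V1 \<Longrightarrow> refl_act s (act t x) \<in> U'"
    using P_aa_quotients[OF assms(1) U'(1,2)] by blast
  obtain V2 where V2: "open V2" "x \<in> V2"
    "\<And>s t. act s x \<in> V2 \<Longrightarrow> act t x \<in> V2 \<Longrightarrow> act s (act t x) \<in> U'"
    using P_aa_products[OF assms(1) U'(1,2)] by blast
  define V where "V = V1 \<inter> V2"
  have "open V" "x \<in> V" using V1 V2 by (auto simp: V_def)
  have ext: "f v \<in> U"
    if f: "continuous_on UNIV f" "\<And>t. act t x \<in> V \<Longrightarrow> f (act t x) \<in> U'" and "v \<in> V" for f v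
  proof (rule ccontr)
    assume "f v \<notin> U"
    then have "v \<in> V \<inter> f -` (- closure U')" using U'(3) that by auto
    moreover have "open (V \<inter> f -` (- closure U'))"
      by (intro open_Int \<open>open V\<close> open_vimage f(1)) auto
    ultimately obtain t where "act t x \<in> V \<inter> f -` (- closure U')"
      using orbit_enters_nhd by blast
    then show False using f(2)[of t] closure_subset[of U'] by auto
  qed
  show ?thesis
  proof (intro exI[of _ V] conjI[OF \<open>open V\<close>] conjI[OF \<open>x \<in> V\<close>] allI impI)
    fix s v assume "act s x \<in> V" "v \<in> V"
    moreover have "continuous_on UNIV (act s)" "continuous_on UNIV (refl_act s)"
      by (intro continuous_intros)+
    ultimately show "act s v \<in> U \<and> refl_act s v \<in> U"
      using ext[of "act s" v] ext[of "refl_act s" v] V1(3) V2(3) by (auto simp: V_def)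
  qed
qed

section \<open>Almost automorphy and the relation Q\<close>

lemma Q_cell_refl: "x \<in> Q_cell act x"
  by (rule Q_cellI[of "{()}" "\<lambda>_ _. True" "\<lambda>_. x" x "\<lambda>_. x" x act "\<lambda>_. 1" x])
    (simp_all add: directed_def)

text \<open>Take u near \<open>x\<close> and u' near \<open>x'\<close> with tu, tu' near z, let k
  carry z into \<open>V'\<close>, and replace u by a nearby orbit point qx. With r = ktq, both rx
  and ktu' lie in \<open>V'\<close>, so r^-1(ktu') = q^-1 u' is in \<open>V\<close>. As qx is in
  \<open>V\<close>, applying q puts u' in \<open>U\<close>, although u' was chosen in the disjoint
  set \<open>U'\<close>.\<close>

lemma P_aa_imp_Q_cell:
  assumes "x \<in> P_aa act"
  shows "Q_cell act x = {x}"
proof -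
  have "x' = x" if x': "x' \<in> Q_cell act x" for x'
  proof (rule ccontr)
    assume "x' \<noteq> x"
    then obtain U U' where U: "open U" "x \<in> U" "open U'" "x' \<in> U'" "U \<inter> U' = {}"
      using hausdorff[of x x'] by blast
    obtain V where V: "open V" "x \<in> V"
      "\<And>s v. act s x \<in> V \<Longrightarrow> v \<in> V \<Longrightarrow> act s v \<in> U \<and> refl_act s v \<in> U"
      using P_aa_equicontinuous_returns[OF assms U(1,2)] by blast
    obtain V' where V': "open V'" "x \<in> V'"
      "\<And>s v. act s x \<in> V' \<Longrightarrow> v \<in> V' \<Longrightarrow> act s v \<in> V \<and> refl_act s v \<in> V"
      using P_aa_equicontinuous_returns[OF assms V(1,2)] by blast
    obtain z where z: "(x, x', z, z) \<in> closure (range (\<lambda>(t, u, u'). (u, u', act t u, act t u')))"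
      using Q_cellE[OF x'] .
    obtain k where "act k z \<in> V'" using orbit_enters_nhd[OF V'(1,2)] .
    define N where "N = act k -` V'"
    have N: "open N" "z \<in> N" using open_vimage_act[OF V'(1)] \<open>act k z \<in> V'\<close> by (simp_all add: N_def)
    have "open (U' \<times> N \<times> N)" "(x', z, z) \<in> U' \<times> N \<times> N"
      using U(3,4) N by (simp_all add: open_Times)
    from closure_pairE[OF z V(1,2) this]
    obtain q where "(\<lambda>(t, u, u'). (u, u', act t u, act t u')) q \<in> V \<times> U' \<times> N \<times> N" .
    then obtain t u u' where tu: "u \<in> V" "u' \<in> U'" "act t u \<in> N" "act t u' \<in> N"
      by (cases q) auto
    then have "open (V \<inter> act t -` N)" "u \<in> V \<inter> act t -` N"
      using V(1) N(1) by (simp_all add: open_Int open_vimage_act)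
    then obtain q where "act q x \<in> V \<inter> act t -` N" by (rule orbit_enters_nhd)
    then have q: "act q x \<in> V" "act k (act t (act q x)) \<in> V'" by (simp_all add: N_def)
    have "act (k * t * q) x \<in> V'" "act k (act t u') \<in> V'"
      using q(2) tu(4) by (simp_all add: N_def act_mult)
    from V'(3)[OF this] have "refl_act (k * t * q) (act k (act t u')) \<in> V" by (rule conjunct2)
    also have "refl_act (k * t * q) (act k (act t u')) = refl_act q u'"
    proof -
      have "act k (act t u') = act (k * t * q) (refl_act q u')" by (simp add: act_mult)
      then show ?thesis by (simp only: refl_act_act)
    qed
    finally have "act q (refl_act q u') \<in> U" using V(3) q(1) by blast
    then show False using tu(2) U(5) by auto
  qed
  then show ?thesis using Q_cell_refl by blast
qed

lemma Q_cell_imp_P_aa: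
  assumes "Q_cell act x = {x}"
  shows "x \<in> P_aa act"
  unfolding P_aa_def mem_Collect_eq
proof (intro allI impI)
  fix D :: "('t \<times> 'x) net_index set" and le t u' y x'
  assume D: "directed D le" and t: "((\<lambda>n. act (t n) x) \<longlongrightarrow> y) (tail_filter D le)"
    and u': "(u' \<longlongrightarrow> x') (tail_filter D le)" and eq: "\<forall>n\<in>D. act (t n) (u' n) = y"
  have "\<forall>\<^sub>F n in tail_filter D le. act (t n) (u' n) = y"
    using eq by (intro eventually_tail_filterI[OF D]) blast
  then have "((\<lambda>n. act (t n) (u' n)) \<longlongrightarrow> y) (tail_filter D le)"
    by (rule tendsto_eventually)
  from Q_cellI[where u = "\<lambda>_. x" and t = t, OF D tendsto_const u' t this] show "x = x'" using assms by simp
qed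

section \<open>Reflection, distality and local almost periodicity\<close>

text \<open>Let t^-1 x be near y and ty near \<open>x'\<close>, and let q^-1 carry y close to
  \<open>x\<close>. Then (qt)^-1 x is close to \<open>x\<close>, hence so is (qt)x, and qt moves
  q^-1 y to ty inside \<open>U\<close>, which keeps ty away from \<open>x'\<close>.\<close>

lemma P_aa_imp_P_aa_reflection:
  assumes "x \<in> P_aa act"
  shows "x \<in> P_aa refl_act"
proof -
  interpret R: minimal_invertible_semiflow refl_act by (rule reflection_minimal_invertible)
  show ?thesis
  proof (rule R.P_aaI, unfold reflection_reflection, rule ccontr)
    fix y x' assume cl: "(y, x') \<in> closure (range (\<lambda>t. (refl_act t x, act t y)))" and "x \<noteq> x'"
    then obtain U U' where U: "open U" "x \<in> U" "open U'" "x' \<in> U'" "U \<inter> U' = {}"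
      using hausdorff[of x x'] by blast
    obtain V where V: "open V" "x \<in> V"
      "\<And>s v. act s x \<in> V \<Longrightarrow> v \<in> V \<Longrightarrow> act s v \<in> U \<and> refl_act s v \<in> U"
      using P_aa_equicontinuous_returns[OF assms U(1,2)] by blast
    obtain V' where V': "open V'" "x \<in> V'" "\<And>s. refl_act s x \<in> V' \<Longrightarrow> act s x \<in> V"
      using P_aa_inverse_return[OF assms V(1,2)] by blast
    have "open (V \<inter> V')" "x \<in> V \<inter> V'" using V V' by auto
    then obtain q where q: "refl_act q y \<in> V \<inter> V'" by (rule R.orbit_enters_nhd)
    obtain t where t: "refl_act q (refl_act t x) \<in> V'" "act t y \<in> U'"
      using closure_pairE[OF cl open_vimage_refl_act[OF V'(1), of q] _ U(3,4)] q by auto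
    have "act (q * t) x \<in> V" using V'(3) t(1) by (simp add: refl_act_mult)
    then have "act (q * t) (refl_act q y) \<in> U" using V(3) q by blast
    also have "act (q * t) (refl_act q y) = act t y"
      by (simp add: act_mult act_commute[of q t])
    finally show False using t(2) U(5) by blast
  qed
qed

text \<open>The return times of \<open>x\<close> to \<open>V\<close> are the required syndetic set.
  For distality, take \<open>- {y}\<close> as the neighbourhood: if tx and ty both lie in
  \<open>V\<close>, then t^-1(ty) = y would avoid y.\<close>

lemma P_aa_imp_distal_lap:
  assumes "x \<in> P_aa act"
  shows "distal_point act x" and "locally_almost_periodic act x"
proof -
  show "locally_almost_periodic act x"
    unfolding locally_almost_periodic_def
  proof (intro allI impI, elim conjE)
    fix U assume U: "open U" "x \<in> U"
    obtain V where V: "open V" "x \<in> V" "\<And>s v. act s x \<in> V \<Longrightarrow> v \<in> V \<Longrightarrow> act s v \<in> U \<and> refl_act s v \<in> U"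
      using P_aa_equicontinuous_returns[OF assms U] by blast
    then have "\<forall>a\<in>{t. act t x \<in> V}. act a ` V \<subseteq> U" by auto
    with V(1,2) syndetic_return_times[OF V(1,2), of x]
    show "\<exists>V A. open V \<and> x \<in> V \<and> syndetic A \<and> (\<forall>a\<in>A. act a ` V \<subseteq> U)"
      by (intro exI conjI)
  qed
  show "distal_point act x"
    unfolding distal_point_def
  proof (intro ballI impI, rule ccontr)
    fix y assume "proximal act x y" "y \<noteq> x"
    then obtain z where z: "(z, z) \<in> closure (range (\<lambda>t. (act t x, act t y)))"
      unfolding proximal_iff_closure by blast
    have "open (- {y})" "x \<in> - {y}" using \<open>y \<noteq> x\<close> by (auto simp: open_Compl)
    from P_aa_equicontinuous_returns[OF assms this]
    obtain V where V: "open V" "x \<in> V"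
      "\<And>s v. act s x \<in> V \<Longrightarrow> v \<in> V \<Longrightarrow> act s v \<in> - {y} \<and> refl_act s v \<in> - {y}" by blast
    obtain k where "act k z \<in> V" using orbit_enters_nhd[OF V(1,2)] .
    then obtain t where "act k (act t x) \<in> V" "act k (act t y) \<in> V"
      using closure_pairE[OF z open_vimage_act[OF V(1), of k] _ open_vimage_act[OF V(1), of k]]
      by auto
    then have "act (k * t) x \<in> V" "act (k * t) y \<in> V" by (simp_all add: act_mult)
    from V(3)[OF this] show False by simp
  qed
qed

text \<open>Let q carry y into \<open>V\<close>. For t^-1 x near y and ty near \<open>x'\<close>,
  some k in \<open>K\<close> has kt in \<open>A\<close>; applied to q t^-1 x and qy in
  \<open>V\<close>, kt gives kqx and kq(ty) in \<open>U'\<close>. Letting ty tend to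
  \<open>x'\<close> makes \<open>x\<close> and \<open>x'\<close> proximal.\<close>

lemma distal_lap_imp_P_aa_reflection:
  assumes "distal_point act x" and "locally_almost_periodic act x"
  shows "x \<in> P_aa refl_act"
proof -
  interpret R: minimal_invertible_semiflow refl_act by (rule reflection_minimal_invertible)
  show ?thesis
  proof (rule R.P_aaI, unfold reflection_reflection)
    fix y x' assume cl: "(y, x') \<in> closure (range (\<lambda>t. (refl_act t x, act t y)))"
    have "\<exists>r. act r x \<in> U \<and> act r x' \<in> U" if "open U" "x \<in> U" for U
    proof -
      obtain U' where U': "open U'" "x \<in> U'" "closure U' \<subseteq> U"
        using regular_nhds[OF \<open>open U\<close> \<open>x \<in> U\<close>] .
      obtain V A where V: "open V" "x \<in> V" "syndetic A" and AV: "\<forall>a\<in>A. act a ` V \<subseteq> U'"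
        using assms(2)[unfolded locally_almost_periodic_def, rule_format, OF conjI[OF U'(1,2)]]
        by blast
      obtain K where K: "compact K" "\<forall>t. (\<lambda>k. k * t) ` K \<inter> A \<noteq> {}"
        using V(3) unfolding syndetic_def by blast
      obtain q where q: "act q y \<in> V" using orbit_enters_nhd[OF V(1,2)] .
      define C where "C = (\<lambda>p. (act (snd p) (act q x), act (snd p) (act q (fst p)))) -`
        (closure U' \<times> closure U')"
      \<comment> \<open>Although k depends on t, compactness of \<open>K\<close> keeps
        \<open>S\<close> closed, so the limit \<open>x'\<close> of the points ty belongs to
        it.\<close>
      define S where "S = {v. \<exists>k\<in>K. (v, k) \<in> C}"
      have "closed C" unfolding C_def
        by (intro closed_vimage closed_Times closed_closure continuous_intros)
      with K(1) have "closed S" unfolding S_def by (rule closed_projection_compact)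
      moreover have "x' \<in> closure S"
        unfolding closure_iff_nhds_not_empty
      proof (intro allI impI)
        fix B N assume "N \<subseteq> B" "open N" "x' \<in> N"
        have "y \<in> act q -` V" using q by simp
        from closure_pairE[OF cl open_vimage_act[OF V(1)] this \<open>open N\<close> \<open>x' \<in> N\<close>]
        obtain t where "(refl_act t x, act t y) \<in> act q -` V \<times> N" .
        then have t: "act q (refl_act t x) \<in> V" "act t y \<in> N" by simp_all
        have "(\<lambda>k. k * t) ` K \<inter> A \<noteq> {}" using K(2) by (rule spec)
        then obtain k where k: "k \<in> K" "k * t \<in> A" by blast
        have "act (k * t) (act q (refl_act t x)) \<in> U'" "act (k * t) (act q y) \<in> U'"
          using bspec[OF AV k(2)] t(1) q by auto
        moreover have "act (k * t) (act q (refl_act t x)) = act k (act q x)"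
          by (simp add: act_mult act_commute[of t q])
        moreover have "act (k * t) (act q y) = act k (act q (act t y))"
          by (simp add: act_mult act_commute[of t q])
        ultimately have "act t y \<in> S"
          using k(1) closure_subset[of U'] by (auto simp: S_def C_def)
        then show "S \<inter> B \<noteq> {}" using t(2) \<open>N \<subseteq> B\<close> by blast
      qed
      ultimately have "x' \<in> S" by (simp only: closure_closed)
      then obtain k where "act k (act q x) \<in> closure U'" "act k (act q x') \<in> closure U'"
        by (auto simp: S_def C_def)
      then show ?thesis using U'(3) by (intro exI[of _ "k * q"]) (auto simp: act_mult)
    qed
    note hit = this
    have "(x, x) \<in> closure (range (\<lambda>r. (act r x, act r x')))"
      unfolding closure_iff_nhds_not_empty
    proof (intro allI impI)
      fix B N assume N: "N \<subseteq> B" "open N" "(x, x) \<in> N"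
      obtain G H where GH: "open G" "open H" "(x, x) \<in> G \<times> H" "G \<times> H \<subseteq> N"
        using open_prod_elim[OF N(2,3)] .
      then obtain r where "act r x \<in> G \<inter> H" "act r x' \<in> G \<inter> H"
        using hit[of "G \<inter> H"] by (auto simp: open_Int)
      then have "(act r x, act r x') \<in> B" using GH(4) N(1) by blast
      then show "range (\<lambda>r. (act r x, act r x')) \<inter> B \<noteq> {}" by blast
    qed
    then have "proximal act x x'" unfolding proximal_iff_closure by blast
    \<comment> \<open>Minimality places \<open>x'\<close> in the orbit closure of \<open>x\<close>,
      as distality of the point demands.\<close>
    then show "x = x'" using assms(1) minimal by (auto simp: distal_point_def minimal_def)
  qed
qed

lemma Q_cell_iff_P_aa: "Q_cell act x = {x} \<longleftrightarrow> x \<in> P_aa act"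
  using Q_cell_imp_P_aa P_aa_imp_Q_cell by blast

end

theorem theorem5p8:
  fixes act :: "'t::topological_comm_monoid_mult \<Rightarrow> 'x::t2_space \<Rightarrow> 'x" and x :: 'x
  assumes "compact (UNIV :: 'x set)"
    and "semiflow act"
    and "minimal act"
    and "invertible_semiflow act"
  shows "(Q_cell act x = {x} \<longleftrightarrow> Q_cell (reflection act) x = {x}) \<and>
         (Q_cell (reflection act) x = {x} \<longleftrightarrow> x \<in> P_aa act) \<and>
         (x \<in> P_aa act \<longleftrightarrow> x \<in> P_aa (reflection act)) \<and>
         (x \<in> P_aa (reflection act) \<longleftrightarrow>
            distal_point act x \<and> locally_almost_periodic act x) \<and>
         (distal_point act x \<and> locally_almost_periodic act x \<longleftrightarrow>
            distal_point (reflection act) x \<and> locally_almost_periodic (reflection act) x)"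
proof -
  interpret F: minimal_invertible_semiflow act using assms by unfold_locales
  interpret R: minimal_invertible_semiflow "reflection act"
    by (rule F.reflection_minimal_invertible)
  \<comment> \<open>Reflecting twice returns \<open>act\<close>, so the implications proved at the
    reflection lead back to the original semiflow.\<close>
  note dual = R.P_aa_imp_P_aa_reflection[unfolded F.reflection_reflection]
    R.distal_lap_imp_P_aa_reflection[unfolded F.reflection_reflection]
  have aa: "x \<in> P_aa act \<longleftrightarrow> x \<in> P_aa (reflection act)"
    by (rule iffI[OF F.P_aa_imp_P_aa_reflection dual(1)])
  have lap: "x \<in> P_aa act \<longleftrightarrow> distal_point act x \<and> locally_almost_periodic act x"
    using F.P_aa_imp_distal_lap[of x] F.distal_lap_imp_P_aa_reflection[of x] aa by argo
  have lap': "x \<in> P_aa (reflection act) \<longleftrightarrow>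
      distal_point (reflection act) x \<and> locally_almost_periodic (reflection act) x"
    using R.P_aa_imp_distal_lap[of x] dual(2)[of x] aa by argo
  show ?thesis
    unfolding F.Q_cell_iff_P_aa R.Q_cell_iff_P_aa lap[symmetric] lap'[symmetric] aa by simp
qed

end
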